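(* Let $n\ge 0$. For any generalized snake word $\mathbf{w}=w_0w_1\cdots w_n$ of length $n$, $$\operatorname{vol}\mathcal{O}(S_n)\ \le\ \operatorname{vol}\mathcal{O}(P(\mathbf{w}))\ \le\ \operatorname{vol}\mathcal{O}(\mathcal{L}_n),$$ where $S_n$ is the snake poset, $\mathcal{L}_n$ is the ladder poset, $P(\mathbf{w})$ is the generalized snake poset of $\mathbf{w}$, $\mathcal{O}(\cdot)$ denotes the order polytope and $\operatorname{vol}$ denotes normalized volume.
   Context: A generalized snake word of length $n\ge 0$ is a word $\mathbf{w}=w_0w_1\cdots w_n$ where $w_0=\varepsilon$ is the empty letter and $w_i\in\{L,R\}$ for $1\le i\le n$. The generalized snake poset $P(\mathbf{w})$ is defined recursively ($\prec$ denotes a cover relation). $P(\varepsilon)$ is the poset on $\{0,1,2,3\}$ with cover relations $1\prec 0$, $2\prec 0$, $3\prec 1$, $3\prec 2$. For $n\ge 1$, $P(w_0\cdots w_n)$ is $P(w_0\cdots w_{n-1})\cup\{2n+2,2n+3\}$ with the added cover relations $2n+3\prec 2n+1$, $2n+3\prec 2n+2$, and: $2n+2\prec 2n-1$ if ($n=1$ and $w_n=L$) or ($n\ge2$ and $w_{n-1}w_n\in\{RL,LR\}$); $2n+2\prec 2n$ if ($n=1$ and $w_n=R$) or ($n\ge 2$ and $w_{n-1}w_n\in\{LL,RR\}$). The snake poset is $S_n=P(\varepsilon LRLR\cdots)$ (length $n$, alternating letters starting with $L$) and the ladder poset is $\mathcal{L}_n=P(\varepsilon LLLL\cdots)$ (length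 $n$, all letters $L$). For a finite poset $P$ with $d$ elements, the order polytope is $\mathcal{O}(P)=\{x\in[0,1]^P : x_i\le x_j \text{ whenever } i<_P j\}$. Its normalized volume is $d!$ times its Euclidean volume (which equals the number of linear extensions of $P$). *)

theory Defs
  imports "HOL-Analysis.Analysis"
begin

datatype letter = L | R

text \<open>
  A generalized snake word \<open>w\<^sub>0w\<^sub>1\<dots>w\<^sub>n\<close> is represented by the list \<open>[w\<^sub>1, \<dots>, w\<^sub>n]\<close>: its first letter
  \<open>w\<^sub>0\<close> is always the empty letter and carries no information.
\<close>

type_synonym snake_word = "letter list"

definition word_letter :: "snake_word \<Rightarrow> nat \<Rightarrow> letter" where
  "word_letter w i = w ! (i - 1)"

text \<open>
  \<open>snake_covers_upto w n\<close> is the set of cover relations of \<open>P(w\<^sub>0\<dots>w\<^sub>n)\<close>, for \<open>n \<le> length w\<close>; a pair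
  \<open>(i, j)\<close> stands for \<open>i \<prec> j\<close>.
\<close>

fun snake_covers_upto :: "snake_word \<Rightarrow> nat \<Rightarrow> nat rel" where
  "snake_covers_upto w 0 = {(1, 0), (2, 0), (3, 1), (3, 2)}"
| "snake_covers_upto w (Suc m) =
    (let n = Suc m in
      snake_covers_upto w m
      \<union> {(2 * n + 3, 2 * n + 1), (2 * n + 3, 2 * n + 2)}
      \<union> (if (n = 1 \<and> word_letter w n = L)
             \<or> (n \<ge> 2 \<and> (word_letter w (n - 1), word_letter w n) \<in> {(R, L), (L, R)})
          then {(2 * n + 2, 2 * n - 1)} else {})
      \<union> (if (n = 1 \<and> word_letter w n = R)
             \<or> (n \<ge> 2 \<and> (word_letter w (n - 1), word_letter w n) \<in> {(L, L), (R, R)})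
          then {(2 * n + 2, 2 * n)} else {}))"

definition snake_covers :: "snake_word \<Rightarrow> nat rel" where
  "snake_covers w = snake_covers_upto w (length w)"

definition snake_carrier :: "snake_word \<Rightarrow> nat set" where
  "snake_carrier w = {0..2 * length w + 3}"

text \<open>The strict order of \<open>P(w)\<close>.\<close>

definition snake_less :: "snake_word \<Rightarrow> nat rel" where
  "snake_less w = (snake_covers w)\<^sup>+"

definition snake_poset_word :: "nat \<Rightarrow> snake_word" where
  "snake_poset_word n = map (\<lambda>i. if odd i then L else R) [1..<Suc n]"

definition ladder_poset_word :: "nat \<Rightarrow> snake_word" where
  "ladder_poset_word n = replicate n L"

text \<open>
  Points of \<open>\<real>\<^sup>A\<close> are the functions on \<open>A\<close> that are \<open>undefined\<close> outside \<open>A\<close>; the relation \<open>lt\<close> is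
  a strict order on \<open>A\<close>.
\<close>

definition order_polytope :: "'a set \<Rightarrow> 'a rel \<Rightarrow> ('a \<Rightarrow> real) set" where
  "order_polytope A lt =
    {x \<in> A \<rightarrow>\<^sub>E {0..1}. \<forall>i\<in>A. \<forall>j\<in>A. (i, j) \<in> lt \<longrightarrow> x i \<le> x j}"

text \<open>The Euclidean volume on \<open>\<real>\<^sup>A\<close> is the product of Lebesgue measures.\<close>

definition normalized_volume :: "'a set \<Rightarrow> ('a \<Rightarrow> real) set \<Rightarrow> real" where
  "normalized_volume A S = fact (card A) * measure (\<Pi>\<^sub>M i\<in>A. lborel) S"

definition snake_polytope_volume :: "snake_word \<Rightarrow> real" where
  "snake_polytope_volume w =
    normalized_volume (snake_carrier w) (order_polytope (snake_carrier w) (snake_less w))"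

text \<open>
  The next facts confirm that \<open>snake_less w\<close> is a strict order on \<open>snake_carrier w\<close> whose cover
  relations are exactly \<open>snake_covers w\<close>, and that order polytopes of finite posets are measurable,
  so that \<^const>\<open>measure\<close> does not take its default value on them.
\<close>

lemma snake_covers_upto_SucD:
  assumes "(i, x) \<in> snake_covers_upto w (Suc m)"
  shows "(i, x) \<in> snake_covers_upto w m \<or>
    i = 2 * m + 5 \<and> x \<in> {2 * m + 3, 2 * m + 4} \<or>
    i = 2 * m + 4 \<and> x = (if (m = 0 \<and> word_letter w 1 = L)
      \<or> (m > 0 \<and> word_letter w m \<noteq> word_letter w (Suc m)) then 2 * m + 1 else 2 * m + 2)"
proof -
  have "(i, x) \<in> snake_covers_upto w m
    \<or> i = 2 * m + 5 \<and> x \<in> {2 * m + 3, 2 * m + 4}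
    \<or> i = 2 * m + 4 \<and> x = 2 * m + 1 \<and> (m = 0 \<and> word_letter w 1 = L
        \<or> m > 0 \<and> word_letter w m \<noteq> word_letter w (Suc m))
    \<or> i = 2 * m + 4 \<and> x = 2 * m + 2 \<and> (m = 0 \<and> word_letter w 1 = R
        \<or> m > 0 \<and> word_letter w m = word_letter w (Suc m))"
    using assms unfolding snake_covers_upto.simps(2) Let_def
  proof (elim UnE)
    assume "(i, x) \<in> {(2 * Suc m + 3, 2 * Suc m + 1), (2 * Suc m + 3, 2 * Suc m + 2)}"
    then have "i = 2 * m + 5 \<and> x \<in> {2 * m + 3, 2 * m + 4}" by auto
    then show ?thesis by blast
  next
    assume "(i, x) \<in> (if Suc m = 1 \<and> word_letter w (Suc m) = L \<or> 2 \<le> Suc m \<and>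
      (word_letter w (Suc m - 1), word_letter w (Suc m)) \<in> {(R, L), (L, R)}
      then {(2 * Suc m + 2, 2 * Suc m - 1)} else {})"
    then have "i = 2 * m + 4 \<and> x = 2 * m + 1 \<and> (m = 0 \<and> word_letter w 1 = L
        \<or> m > 0 \<and> word_letter w m \<noteq> word_letter w (Suc m))"
      by (auto split: if_splits)
    then show ?thesis by blast
  next
    assume "(i, x) \<in> (if Suc m = 1 \<and> word_letter w (Suc m) = R \<or> 2 \<le> Suc m \<and>
      (word_letter w (Suc m - 1), word_letter w (Suc m)) \<in> {(L, L), (R, R)}
      then {(2 * Suc m + 2, 2 * Suc m)} else {})"
    then have "i = 2 * m + 4 \<and> x = 2 * m + 2 \<and> (m = 0 \<and> word_letter w 1 = R
        \<or> m > 0 \<and> word_letter w m = word_letter w (Suc m))"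
      by (auto split: if_splits)
    then show ?thesis by blast
  qed blast
  then show ?thesis
    by (smt (verit) letter.distinct(1) less_irrefl)
qed

lemma snake_covers_upto_bounds:
  "(i, j) \<in> snake_covers_upto w n \<Longrightarrow> j < i \<and> i \<le> 2 * n + 3"
proof (induction n)
  case (Suc m)
  show ?case
    using snake_covers_upto_SucD[OF Suc.prems]
  proof (elim disjE)
    assume "(i, j) \<in> snake_covers_upto w m"
    then show ?thesis using Suc.IH by simp
  qed (simp_all split: if_splits, auto?)
qed auto

lemma snake_covers_upto_gap:
  "(i, j) \<in> snake_covers_upto w n \<Longrightarrow> (i, k) \<in> snake_covers_upto w n \<Longrightarrow> j < k
    \<Longrightarrow> odd i \<and> k = Suc j \<and> i = Suc k"
proof (induction n)
  case 0
  then show ?case by auto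
next
  case (Suc m)
  show ?case
  proof (cases "i \<le> 2 * m + 3")
    case True
    then have "(i, j) \<in> snake_covers_upto w m" "(i, k) \<in> snake_covers_upto w m"
      using Suc.prems(1,2) by (auto simp: Let_def split: if_splits)
    then show ?thesis using Suc.IH Suc.prems(3) by blast
  next
    case False
    then have "(i, x) \<notin> snake_covers_upto w m" for x
      using snake_covers_upto_bounds[of i x w m] by blast
    then have new: "i = 2 * m + 5 \<and> x \<in> {2 * m + 3, 2 * m + 4} \<or>
      i = 2 * m + 4 \<and> x = (if (m = 0 \<and> word_letter w 1 = L)
        \<or> (m > 0 \<and> word_letter w m \<noteq> word_letter w (Suc m)) then 2 * m + 1 else 2 * m + 2)"
      if "(i, x) \<in> snake_covers_upto w (Suc m)" for x
      using snake_covers_upto_SucD[OF that] by blast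
    show ?thesis
    proof (cases "i = 2 * m + 4")
      case True
      then show ?thesis
        using new[OF Suc.prems(1)] new[OF Suc.prems(2)] Suc.prems(3) by simp
    next
      case False
      then have "i = 2 * m + 5" "j \<in> {2 * m + 3, 2 * m + 4}" "k \<in> {2 * m + 3, 2 * m + 4}"
        using new[OF Suc.prems(1)] new[OF Suc.prems(2)] by blast+
      then show ?thesis using Suc.prems(3) by auto
    qed
  qed
qed

lemma snake_covers_upto_Suc:
  "(Suc k, k) \<in> snake_covers_upto w n \<Longrightarrow> even k"
proof (induction n)
  case (Suc m)
  show ?case
    using snake_covers_upto_SucD[OF Suc.prems]
  proof (elim disjE)
    assume "(Suc k, k) \<in> snake_covers_upto w m"
    then show ?thesis using Suc.IH by simp
  qed (simp_all split: if_splits, auto?)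
qed auto

lemma snake_less_bounds:
  assumes "(i, j) \<in> snake_less w" shows "j < i \<and> i \<le> 2 * length w + 3"
  using assms unfolding snake_less_def snake_covers_def
  by (induction rule: trancl_induct) (auto dest: snake_covers_upto_bounds)

lemma snake_less_strict_order:
  "snake_less w \<subseteq> snake_carrier w \<times> snake_carrier w" "trans (snake_less w)" "irrefl (snake_less w)"
proof -
  show "snake_less w \<subseteq> snake_carrier w \<times> snake_carrier w"
    by (auto simp: snake_carrier_def dest: snake_less_bounds)
  show "trans (snake_less w)" by (simp add: snake_less_def)
  show "irrefl (snake_less w)" by (auto simp: irrefl_def dest: snake_less_bounds)
qed

lemma snake_less_first_cover:
  "(i, k) \<in> snake_less w \<Longrightarrow> \<exists>l. (i, l) \<in> snake_covers w \<and> (l = k \<or> (l, k) \<in> snake_less w)"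
  unfolding snake_less_def by (erule converse_tranclE) auto

lemma snake_covers_iff:
  "(i, j) \<in> snake_covers w \<longleftrightarrow>
    (i, j) \<in> snake_less w \<and> \<not> (\<exists>k. (i, k) \<in> snake_less w \<and> (k, j) \<in> snake_less w)"
proof
  assume c: "(i, j) \<in> snake_covers w"
  have False if ik: "(i, k) \<in> snake_less w" and kj: "(k, j) \<in> snake_less w" for k
  proof -
    obtain l where l: "(i, l) \<in> snake_covers w" "l = k \<or> (l, k) \<in> snake_less w"
      using snake_less_first_cover[OF ik] by blast
    have lj: "(l, j) \<in> snake_less w"
      using l(2) kj unfolding snake_less_def by auto
    then have "j < l" using snake_less_bounds by blast
    then have s: "odd i" "l = Suc j" "i = Suc l"
      using snake_covers_upto_gap[of i j w "length w" l] c l(1)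
      by (auto simp: snake_covers_def)
    obtain m where m: "(l, m) \<in> snake_covers w" "m = j \<or> (m, j) \<in> snake_less w"
      using snake_less_first_cover[OF lj] by blast
    have "m < l" using m(1) snake_covers_upto_bounds unfolding snake_covers_def by blast
    then have "m = j" using m(2) s(2) snake_less_bounds[of m j w] by auto
    then have "even j"
      using m(1) s(2) snake_covers_upto_Suc unfolding snake_covers_def by blast
    then show False
      using s by auto
  qed
  then show "(i, j) \<in> snake_less w \<and> \<not> (\<exists>k. (i, k) \<in> snake_less w \<and> (k, j) \<in> snake_less w)"
    using c unfolding snake_less_def by auto
next
  assume a: "(i, j) \<in> snake_less w \<and> \<not> (\<exists>k. (i, k) \<in> snake_less w \<and> (k, j) \<in> snake_less w)"
  then have "(i, j) \<in> (snake_covers w)\<^sup>+" by (simp add: snake_less_def)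
  then show "(i, j) \<in> snake_covers w"
    using a unfolding snake_less_def by cases auto
qed

lemma sets_order_polytope:
  assumes "finite A"
  shows "order_polytope A lt \<in> sets (\<Pi>\<^sub>M i\<in>A. (lborel :: real measure))"
proof -
  let ?M = "\<Pi>\<^sub>M i\<in>A. (lborel :: real measure)"
  have "order_polytope A lt =
    {x \<in> space ?M. (\<forall>i\<in>A. 0 \<le> x i \<and> x i \<le> 1) \<and> (\<forall>i\<in>A. \<forall>j\<in>A. (i, j) \<in> lt \<longrightarrow> x i \<le> x j)}"
    by (auto simp: order_polytope_def space_PiM PiE_iff)
  also have "\<dots> \<in> sets ?M"
  proof -
    have c [measurable]: "(\<lambda>x. x i) \<in> borel_measurable ?M" if "i \<in> A" for i
      using measurable_component_singleton[OF that, of "\<lambda>_. lborel :: real measure"] by simp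
    have [measurable]: "Measurable.pred ?M (\<lambda>x. x i \<le> x j)" if "i \<in> A" "j \<in> A" for i j
      using borel_measurable_le[OF c[OF that(1)] c[OF that(2)]] by (simp add: pred_def)
    show ?thesis using assms by measurable
  qed
  finally show ?thesis .
qed

end

theory Submission
  imports Defs
begin

text \<open>
  Up to exchanging the elements 1 and 2, a generalized snake poset is determined by the steps at which
  the word repeats a letter (the new element \<open>2k + 4\<close> hangs under \<open>2k + 2\<close>) or changes it (it hangs
  under \<open>2k + 1\<close>). The volume can only grow when a single change at step \<open>i\<close> becomes a repetition:
  if a point \<open>x\<close> of the old polytope violates the new condition, then \<open>x (2i + 1) > x (2i + 2)\<close>, and
  exchanging these two coordinates gives a point of the new polytope that violates the old condition.
  The snake has only changes, and the ladder only repetitions after its first step.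
\<close>

section \<open>Permutations of coordinates in a product measure\<close>

lemma distr_PiM_permutes:
  fixes M :: "'b measure"
  assumes "sigma_finite_measure M" "finite A" "p permutes A"
  shows "distr (\<Pi>\<^sub>M i\<in>A. M) (\<Pi>\<^sub>M i\<in>A. M) (\<lambda>x. \<lambda>i\<in>A. x (p i)) = (\<Pi>\<^sub>M i\<in>A. M)"
proof -
  interpret sigma_finite_measure M by fact
  interpret product_sigma_finite "\<lambda>_::'a. M" by unfold_locales
  let ?P = "\<Pi>\<^sub>M i\<in>A. M" and ?f = "\<lambda>x. \<lambda>i\<in>A. x (p i)"
  have pA: "p i \<in> A \<longleftrightarrow> i \<in> A" for i
    using assms(3) by (rule permutes_in_image)
  have f: "?f \<in> measurable ?P ?P"
    by (rule measurable_restrict) (auto simp: pA intro: measurable_component_singleton)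
  show ?thesis
  proof (rule PiM_eqI[OF assms(2)])
    fix B assume B: "\<And>i. i \<in> A \<Longrightarrow> B i \<in> sets M"
    have inv: "inv p i \<in> A" if "i \<in> A" for i
      using permutes_in_image[OF permutes_inv[OF assms(3)]] that by simp
    \<comment> \<open>The product measure is determined by its values on boxes. The preimage of a
      box is the box with its sides relabelled by \<open>inv p\<close>, so the product of the side
      measures is only reordered.\<close>
    have "?f -` Pi\<^sub>E A B \<inter> space ?P = (\<Pi>\<^sub>E i\<in>A. B (inv p i))"
    proof (intro set_eqI iffI)
      fix x assume x: "x \<in> ?f -` Pi\<^sub>E A B \<inter> space ?P"
      have "x i \<in> B (inv p i)" if "i \<in> A" for i
      proof -
        have "?f x (inv p i) \<in> B (inv p i)" using x inv[OF that] by blast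
        then show ?thesis
          using inv[OF that] by (simp add: permutes_inverses(1)[OF assms(3)])
      qed
      then show "x \<in> (\<Pi>\<^sub>E i\<in>A. B (inv p i))"
        using x by (auto simp: space_PiM PiE_iff)
    next
      fix x assume x: "x \<in> (\<Pi>\<^sub>E i\<in>A. B (inv p i))"
      have "x (p i) \<in> B i" if "i \<in> A" for i
        using PiE_mem[OF x, of "p i"] that by (simp add: pA permutes_inverses(2)[OF assms(3)])
      moreover have "x i \<in> space M" if "i \<in> A" for i
        using PiE_mem[OF x that] sets.sets_into_space[OF B[OF inv[OF that]]] by blast
      ultimately show "x \<in> ?f -` Pi\<^sub>E A B \<inter> space ?P"
        using x by (auto simp: space_PiM PiE_iff)
    qed
    then have "emeasure (distr ?P ?P ?f) (Pi\<^sub>E A B) = emeasure ?P (\<Pi>\<^sub>E i\<in>A. B (inv p i))"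
      using B by (subst emeasure_distr[OF f]) (auto intro!: sets_PiM_I_finite assms(2))
    also have "\<dots> = (\<Prod>i\<in>A. emeasure M (B (inv p i)))"
      using B inv by (intro emeasure_PiM assms(2)) auto
    also have "\<dots> = (\<Prod>i\<in>A. emeasure M (B i))"
      using prod.permute[OF permutes_inv[OF assms(3)], of "\<lambda>i. emeasure M (B i)"]
      by (simp add: o_def)
    finally show "emeasure (distr ?P ?P ?f) (Pi\<^sub>E A B) = (\<Prod>i\<in>A. emeasure M (B i))" .
  qed simp
qed

text \<open>The permutation of coordinates preserves the measure, and \<open>S\<close> lies in the
  preimage of \<open>T\<close>. This gives volume comparisons from injections that only permute
  coordinates.\<close>

lemma emeasure_PiM_le_of_permutes:
  fixes M :: "'b measure"
  assumes "sigma_finite_measure M" "finite A" "p permutes A"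
    and S: "S \<in> sets (\<Pi>\<^sub>M i\<in>A. M)" and T: "T \<in> sets (\<Pi>\<^sub>M i\<in>A. M)"
    and ST: "\<And>x. x \<in> S \<Longrightarrow> (\<lambda>i\<in>A. x (p i)) \<in> T"
  shows "emeasure (\<Pi>\<^sub>M i\<in>A. M) S \<le> emeasure (\<Pi>\<^sub>M i\<in>A. M) T"
proof -
  let ?P = "\<Pi>\<^sub>M i\<in>A. M" and ?f = "\<lambda>x. \<lambda>i\<in>A. x (p i)"
  have f: "?f \<in> measurable ?P ?P"
    by (rule measurable_restrict)
      (auto simp: permutes_in_image[OF assms(3)] intro: measurable_component_singleton)
  have "emeasure ?P S \<le> emeasure ?P (?f -` T \<inter> space ?P)"
    using ST sets.sets_into_space[OF S] by (intro emeasure_mono measurable_sets[OF f T]) auto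
  also have "\<dots> = emeasure (distr ?P ?P ?f) T"
    by (simp add: emeasure_distr[OF f T])
  finally show ?thesis
    by (simp add: distr_PiM_permutes[OF assms(1-3)])
qed

section \<open>Order polytopes and generating relations\<close>

lemma emeasure_order_polytope_finite:
  assumes "finite A"
  shows "emeasure (\<Pi>\<^sub>M i\<in>A. lborel) (order_polytope A r) < \<infinity>"
proof -
  interpret product_sigma_finite "\<lambda>_::'a. lborel :: real measure" by unfold_locales
  have "emeasure (\<Pi>\<^sub>M i\<in>A. lborel) (order_polytope A r)
      \<le> emeasure (\<Pi>\<^sub>M i\<in>A. lborel) (\<Pi>\<^sub>E i\<in>A. {0..1::real})"
    using assms by (intro emeasure_mono) (auto simp: order_polytope_def intro!: sets_PiM_I_finite)
  also have "\<dots> = 1"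
    using assms by (subst emeasure_PiM) auto
  finally show ?thesis
    by (rule order.strict_trans1) simp
qed

text \<open>Inequalities compose along chains; \<open>r \<subseteq> A \<times> A\<close> keeps every
  intermediate element in \<open>A\<close>. Hence the cover relations can replace the order they
  generate.\<close>

lemma order_polytope_trancl:
  assumes "r \<subseteq> A \<times> A"
  shows "order_polytope A (r\<^sup>+) = order_polytope A r"
proof -
  have "x i \<le> x j" if "x \<in> order_polytope A r" "(i, j) \<in> r\<^sup>+" for x i j
    using that(2)
  proof induction
    case (base j)
    then show ?case using that(1) assms by (auto simp: order_polytope_def)
  next
    case (step j k)
    then have "x j \<le> x k" using that(1) assms by (auto simp: order_polytope_def)
    then show ?case using step.IH by simp
  qed
  then show ?thesis
    unfolding order_polytope_def by (blast intro: r_into_trancl')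
qed

section \<open>Generalized snake posets encoded by one Boolean per step\<close>

definition choice_covers :: "nat \<Rightarrow> (nat \<Rightarrow> bool) \<Rightarrow> nat rel" where
  "choice_covers n c = {(1, 0), (2, 0)}
    \<union> (\<Union>k\<in>{..n}. {(2 * k + 3, 2 * k + 1), (2 * k + 3, 2 * k + 2)})
    \<union> (\<lambda>k. (2 * k + 4, if c k then 2 * k + 2 else 2 * k + 1)) ` {..<n}"

abbreviation choice_polytope :: "nat \<Rightarrow> (nat \<Rightarrow> bool) \<Rightarrow> (nat \<Rightarrow> real) set" where
  "choice_polytope n c \<equiv> order_polytope {0..2 * n + 3} (choice_covers n c)"

definition choice_volume :: "nat \<Rightarrow> (nat \<Rightarrow> bool) \<Rightarrow> real" where
  "choice_volume n c = normalized_volume {0..2 * n + 3} (choice_polytope n c)"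

text \<open>Step \<open>k\<close> adds the letter w_(k+1), stored as \<open>w ! k\<close>, and
  compares it with w_k, stored as \<open>w ! (k - 1)\<close>. At step 0 there is no previous letter:
  a first R hangs 4 under 2, as a repetition would, and a first L hangs it under 1, as a change
  would.\<close>

definition word_choice :: "snake_word \<Rightarrow> nat \<Rightarrow> bool" where
  "word_choice w k = (if k = 0 then w ! 0 = R else w ! (k - 1) = w ! k)"

lemma choice_covers_subset: "choice_covers n c \<subseteq> {0..2 * n + 3} \<times> {0..2 * n + 3}"
  by (auto simp: choice_covers_def)

lemma choice_covers_cong:
  "(\<And>k. k < n \<Longrightarrow> c k = d k) \<Longrightarrow> choice_covers n c = choice_covers n d"
  unfolding choice_covers_def by (intro arg_cong2[where f = "(\<union>)"] refl image_cong) auto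

lemma choice_covers_Suc:
  "choice_covers (Suc m) c = choice_covers m c \<union> {(2 * m + 5, 2 * m + 3), (2 * m + 5, 2 * m + 4)}
    \<union> {(2 * m + 4, if c m then 2 * m + 2 else 2 * m + 1)}"
proof -
  have eqs: "2 * Suc m + 3 = 2 * m + 5" "2 * Suc m + 1 = 2 * m + 3" "2 * Suc m + 2 = 2 * m + 4"
    by simp_all
  show ?thesis
    unfolding choice_covers_def atMost_Suc lessThan_Suc UN_insert image_insert eqs by blast
qed

lemma snake_covers_upto_eq: "snake_covers_upto w m = choice_covers m (word_choice w)"
proof (induction m)
  case 0
  show ?case by (auto simp: choice_covers_def)
next
  case (Suc m)
  \<comment> \<open>Exactly one of the two conditions of the recursion holds for any letters, so a
    single Boolean records the step.\<close>
  have turn: "(Suc m = 1 \<and> word_letter w (Suc m) = L) \<or> (Suc m \<ge> 2 \<and>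
      (word_letter w (Suc m - 1), word_letter w (Suc m)) \<in> {(R, L), (L, R)})
    \<longleftrightarrow> \<not> word_choice w m"
    by (cases "m = 0"; cases "w ! (m - 1)"; cases "w ! m")
      (simp_all add: word_letter_def word_choice_def)
  have straight: "(Suc m = 1 \<and> word_letter w (Suc m) = R) \<or> (Suc m \<ge> 2 \<and>
      (word_letter w (Suc m - 1), word_letter w (Suc m)) \<in> {(L, L), (R, R)})
    \<longleftrightarrow> word_choice w m"
    by (cases "m = 0"; cases "w ! (m - 1)"; cases "w ! m")
      (simp_all add: word_letter_def word_choice_def)
  have eqs: "2 * Suc m = 2 * m + 2" "2 * m + 2 + 3 = 2 * m + 5" "2 * m + 2 + 1 = 2 * m + 3"
    "2 * m + 2 + 2 = 2 * m + 4" "2 * m + 2 - 1 = 2 * m + 1"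
    by simp_all
  show ?case
    unfolding snake_covers_upto.simps(2) Let_def turn straight Suc.IH choice_covers_Suc eqs
    by (cases "word_choice w m") simp_all
qed

lemma snake_polytope_volume_eq:
  "snake_polytope_volume w = choice_volume (length w) (word_choice w)"
  unfolding snake_polytope_volume_def choice_volume_def snake_carrier_def snake_less_def
    snake_covers_def snake_covers_upto_eq order_polytope_trancl[OF choice_covers_subset] ..

lemma mem_choice_polytope:
  "x \<in> choice_polytope n c \<longleftrightarrow> x \<in> {0..2 * n + 3} \<rightarrow>\<^sub>E {0..1} \<and> x 1 \<le> x 0 \<and> x 2 \<le> x 0
    \<and> (\<forall>k\<le>n. x (2 * k + 3) \<le> x (2 * k + 1) \<and> x (2 * k + 3) \<le> x (2 * k + 2))
    \<and> (\<forall>k<n. x (2 * k + 4) \<le> x (if c k then 2 * k + 2 else 2 * k + 1))"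
proof -
  have "x \<in> choice_polytope n c \<longleftrightarrow> x \<in> {0..2 * n + 3} \<rightarrow>\<^sub>E {0..1}
      \<and> (\<forall>(i, j)\<in>choice_covers n c. x i \<le> x j)"
    using choice_covers_subset[of n c] unfolding order_polytope_def by blast
  also have "(\<forall>(i, j)\<in>choice_covers n c. x i \<le> x j) \<longleftrightarrow> x 1 \<le> x 0 \<and> x 2 \<le> x 0
    \<and> (\<forall>k\<in>{..n}. x (2 * k + 3) \<le> x (2 * k + 1) \<and> x (2 * k + 3) \<le> x (2 * k + 2))
    \<and> (\<forall>k\<in>{..<n}. x (2 * k + 4) \<le> x (if c k then 2 * k + 2 else 2 * k + 1))"
    unfolding choice_covers_def by (simp add: ball_Un)
  finally show ?thesis
    unfolding Ball_def atMost_iff lessThan_iff .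
qed

text \<open>The element \<open>2 * i + 3\<close> lies below both exchanged elements, and flipping
  the choice at \<open>i\<close> moves \<open>2 * i + 4\<close> along with its upper cover. From
  above, 1 and 2 are symmetric if \<open>i = 0\<close>. Otherwise \<open>2 * i + 1\<close> must lie
  below both \<open>2 * i - 1\<close> and \<open>2 * i\<close>, but \<open>2 * i + 2\<close> below
  only one of them; this asymmetry is what \<open>le\<close> makes up for.\<close>

lemma swap_mem_choice_polytope:
  fixes x :: "nat \<Rightarrow> real"
  assumes x: "x \<in> choice_polytope n c" and i: "i < n"
    and le: "i = 0 \<or> x (2 * i + 2) \<le> x (2 * i + 1)"
    and d: "\<And>k. k \<noteq> i \<Longrightarrow> d k = c k" "d i \<noteq> c i"
  shows "(\<lambda>j\<in>{0..2 * n + 3}. x (Transposition.transpose (2 * i + 1) (2 * i + 2) j)) \<in> choice_polytope n d"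
proof -
  define p where "p = Transposition.transpose (2 * i + 1) (2 * i + 2)"
  define y where "y = (\<lambda>j\<in>{0..2 * n + 3}. x (p j))"
  have y1: "y (2 * i + 1) = x (2 * i + 2)" and y2: "y (2 * i + 2) = x (2 * i + 1)"
    using i by (simp_all add: y_def p_def)
  have yo: "y j = x j" if "j \<noteq> 2 * i + 1" "j \<noteq> 2 * i + 2" "j \<le> 2 * n + 3" for j
    using that by (simp add: y_def p_def)
  have X: "x \<in> {0..2 * n + 3} \<rightarrow>\<^sub>E {0..1}" "x 1 \<le> x 0" "x 2 \<le> x 0"
    "\<And>k. k \<le> n \<Longrightarrow> x (2 * k + 3) \<le> x (2 * k + 1)"
    "\<And>k. k \<le> n \<Longrightarrow> x (2 * k + 3) \<le> x (2 * k + 2)"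
    "\<And>k. k < n \<Longrightarrow> x (2 * k + 4) \<le> x (if c k then 2 * k + 2 else 2 * k + 1)"
    using x unfolding mem_choice_polytope by auto
  have p: "p permutes {0..2 * n + 3}"
    unfolding p_def using i by (intro permutes_swap_id) auto
  have "x (p j) \<in> {0..1}" if "j \<in> {0..2 * n + 3}" for j
    using PiE_mem[OF X(1)] that permutes_in_image[OF p, of j] by blast
  then have "y \<in> {0..2 * n + 3} \<rightarrow>\<^sub>E {0..1}"
    unfolding y_def by (simp only: restrict_PiE_iff) blast
  moreover have "y 1 \<le> y 0 \<and> y 2 \<le> y 0"
  proof (cases "i = 0")
    case True
    have "y 1 = x 2" "y 2 = x 1" using y1 y2 unfolding True by (simp_all del: add_2_eq_Suc')
    then show ?thesis using yo[of 0] X(2,3) by simp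
  next
    case False
    then show ?thesis using yo[of 0] yo[of 1] yo[of 2] X(2,3) by simp
  qed
  moreover have "y (2 * k + 3) \<le> y (2 * k + 1) \<and> y (2 * k + 3) \<le> y (2 * k + 2)" if k: "k \<le> n" for k
  proof -
    \<comment> \<open>The exchanged elements occur as the upper ends of these inequalities, then as
      a lower end, then not at all.\<close>
    consider "k = i" | "Suc k = i" | "k \<noteq> i" "Suc k \<noteq> i" by blast
    then show ?thesis
    proof cases
      case 1
      then show ?thesis using y1 y2 yo[of "2 * k + 3"] X(4,5)[OF k] k by simp
    next
      case 2
      then have "2 * i + 1 = 2 * k + 3" "2 * i + 2 = 2 * k + 4" "i \<noteq> 0" by auto
      then have "y (2 * k + 3) = x (2 * k + 4)" "x (2 * k + 4) \<le> x (2 * k + 3)"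
        using y1 le by (simp_all only: simp_thms)
      then show ?thesis
        using yo[of "2 * k + 1"] yo[of "2 * k + 2"] X(4,5)[OF k] k 2 by auto
    next
      case 3
      then have "2 * k + 3 \<noteq> 2 * i + 1" "2 * k + 3 \<noteq> 2 * i + 2" "2 * k + 1 \<noteq> 2 * i + 1"
        "2 * k + 1 \<noteq> 2 * i + 2" "2 * k + 2 \<noteq> 2 * i + 1" "2 * k + 2 \<noteq> 2 * i + 2"
        by presburger+
      then show ?thesis using yo X(4,5)[OF k] k by simp
    qed
  qed
  moreover have "y (2 * k + 4) \<le> y (if d k then 2 * k + 2 else 2 * k + 1)" if k: "k < n" for k
  proof -
    consider "k = i" | "Suc k = i" | "k \<noteq> i" "Suc k \<noteq> i" by blast
    then show ?thesis
    proof cases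
      case 1
      then show ?thesis using y1 y2 yo[of "2 * k + 4"] X(6)[OF k] k d(2) by (cases "c i") auto
    next
      case 2
      then have "2 * i + 1 = 2 * k + 3" "2 * i + 2 = 2 * k + 4" by auto
      \<comment> \<open>The value \<open>x (2 * k + 3)\<close> is below both candidates for the
        upper cover of \<open>2 * k + 4\<close>.\<close>
      then have "y (2 * k + 4) = x (2 * k + 3)" using y2 by (simp only:)
      then show ?thesis
        using yo[of "2 * k + 1"] yo[of "2 * k + 2"] X(4,5)[of k] k 2 by auto
    next
      case 3
      then have "2 * k + 4 \<noteq> 2 * i + 1" "2 * k + 4 \<noteq> 2 * i + 2" "2 * k + 1 \<noteq> 2 * i + 1"
        "2 * k + 1 \<noteq> 2 * i + 2" "2 * k + 2 \<noteq> 2 * i + 1" "2 * k + 2 \<noteq> 2 * i + 2"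
        by presburger+
      then show ?thesis using yo X(6)[OF k] k d(1)[OF 3(1)] by simp
    qed
  qed
  ultimately show ?thesis
    unfolding mem_choice_polytope y_def[symmetric, unfolded p_def] by blast
qed

section \<open>Monotonicity of the volume in the choices\<close>

lemma choice_volume_le_emeasure:
  assumes "emeasure (\<Pi>\<^sub>M i\<in>{0..2 * n + 3}. lborel) (choice_polytope n c)
    \<le> emeasure (\<Pi>\<^sub>M i\<in>{0..2 * n + 3}. lborel) (choice_polytope n d)"
  shows "choice_volume n c \<le> choice_volume n d"
  \<comment> \<open>Since \<open>enn2real\<close> sends infinity to 0, passing to real measures
    needs a finite right-hand side.\<close>
  using assms emeasure_order_polytope_finite[of "{0..2 * n + 3}" "choice_covers n d"]
  unfolding choice_volume_def normalized_volume_def measure_def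
  by (intro mult_left_mono enn2real_mono) auto

text \<open>The intersection of the two polytopes contributes equally to both volumes, so only the
  differences are compared. There the old condition and the failure of the new one supply the
  inequality required by \<open>swap_mem_choice_polytope\<close>.\<close>

lemma choice_volume_straighten:
  assumes i: "i < n" and c: "\<not> c i"
  shows "choice_volume n c \<le> choice_volume n (c(i := True))"
proof -
  let ?A = "{0..2 * n + 3}" and ?d = "c(i := True)"
  let ?M = "\<Pi>\<^sub>M j\<in>?A. lborel :: real measure"
  let ?C = "choice_polytope n c" and ?D = "choice_polytope n ?d"
  have sets: "?C \<in> sets ?M" "?D \<in> sets ?M"
    by (intro sets_order_polytope finite_atLeastAtMost)+
  have split: "emeasure ?M (S \<inter> T) + emeasure ?M (S - T) = emeasure ?M S"
    if "S \<in> sets ?M" "T \<in> sets ?M" for S T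
    using plus_emeasure[OF sets.Int[OF that] sets.Diff[OF that]] by (auto simp: Int_Diff_Un)
  have "emeasure ?M (?C - ?D) \<le> emeasure ?M (?D - ?C)"
  proof (rule emeasure_PiM_le_of_permutes)
    show "Transposition.transpose (2 * i + 1) (2 * i + 2) permutes ?A"
      using i by (intro permutes_swap_id) auto
    fix x assume x: "x \<in> ?C - ?D"
    let ?y = "\<lambda>j\<in>?A. x (Transposition.transpose (2 * i + 1) (2 * i + 2) j)"
    have xC: "x \<in> ?C" and xD: "x \<notin> ?D" using x by simp_all
    have side: "x (2 * k + 4) \<le> x (if c k then 2 * k + 2 else 2 * k + 1)" if "k < n" for k
      using xC that mem_choice_polytope by blast
    have old: "x (2 * i + 4) \<le> x (2 * i + 1)"
      using side[OF i] c by simp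
    have new: "\<not> x (2 * i + 4) \<le> x (2 * i + 2)"
    proof
      assume "x (2 * i + 4) \<le> x (2 * i + 2)"
      then have "x (2 * k + 4) \<le> x (if ?d k then 2 * k + 2 else 2 * k + 1)" if "k < n" for k
        using side[OF that] by (cases "k = i") simp_all
      then have "x \<in> ?D"
        using xC unfolding mem_choice_polytope by blast
      then show False using xD by simp
    qed
    have "?y \<in> ?D"
      using xC i old new c by (intro swap_mem_choice_polytope[where c = c]) auto
    \<comment> \<open>The exchange fixes coordinate \<open>2 * i + 4\<close> and puts
      \<open>x (2 * i + 2)\<close> at \<open>2 * i + 1\<close>, so the old condition for
      \<open>?y\<close> is the new condition for \<open>x\<close>, which fails.\<close>
    moreover have "?y \<notin> ?C"
    proof
      assume "?y \<in> ?C"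
      then have "?y (2 * i + 4) \<le> ?y (2 * i + 1)"
        using i c unfolding mem_choice_polytope by auto
      then show False using i new by simp
    qed
    ultimately show "?y \<in> ?D - ?C" by blast
  qed (use sets in \<open>auto intro: lborel.sigma_finite_measure_axioms\<close>)
  then have "emeasure ?M (?C \<inter> ?D) + emeasure ?M (?C - ?D)
      \<le> emeasure ?M (?D \<inter> ?C) + emeasure ?M (?D - ?C)"
    by (simp add: Int_commute add_left_mono)
  then have "emeasure ?M ?C \<le> emeasure ?M ?D"
    using split[OF sets] split[OF sets(2,1)] by simp
  then show ?thesis by (rule choice_volume_le_emeasure)
qed

text \<open>At step 0 the exchange of 1 and 2 maps the whole polytope into the other one, since both
  elements lie directly under 0.\<close>

lemma choice_volume_swap_first:
  assumes "0 < n"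
  shows "choice_volume n c \<le> choice_volume n (c(0 := \<not> c 0))"
proof (rule choice_volume_le_emeasure, rule emeasure_PiM_le_of_permutes)
  show "Transposition.transpose (2 * 0 + 1) (2 * 0 + 2) permutes {0..2 * n + 3}"
    using assms by (intro permutes_swap_id) auto
  show "(\<lambda>j\<in>{0..2 * n + 3}. x (Transposition.transpose (2 * 0 + 1) (2 * 0 + 2) j))
      \<in> choice_polytope n (c(0 := \<not> c 0))" if "x \<in> choice_polytope n c" for x
    using that assms by (intro swap_mem_choice_polytope[where c = c]) auto
qed (auto intro: sets_order_polytope lborel.sigma_finite_measure_axioms)

text \<open>Only the first \<open>n\<close> choices enter the poset; beyond them
  \<open>word_choice\<close> reads past the end of the word.\<close>

lemma choice_volume_cong:
  "(\<And>k. k < n \<Longrightarrow> c k = d k) \<Longrightarrow> choice_volume n c = choice_volume n d"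
  unfolding choice_volume_def by (metis choice_covers_cong)

text \<open>The choices of \<open>c\<close> are replaced by those of \<open>d\<close> one index at a
  time, from the left. Each replacement either changes nothing or straightens a single step.\<close>

lemma choice_volume_mono:
  assumes "\<And>k. k < n \<Longrightarrow> c k \<Longrightarrow> d k"
  shows "choice_volume n c \<le> choice_volume n d"
proof -
  have "m \<le> n \<Longrightarrow> choice_volume n c \<le> choice_volume n (\<lambda>k. if k < m then d k else c k)" for m
  proof (induction m)
    case (Suc m)
    let ?e = "\<lambda>m k. if k < m then d k else c k"
    show ?case
    proof (cases "c m = d m")
      case True
      then have "?e (Suc m) = ?e m" by (auto simp: fun_eq_iff less_Suc_eq)
      then show ?thesis using Suc by simp
    next
      case False
      then have "\<not> c m" "d m" using assms[of m] Suc.prems by auto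
      moreover from this have "?e (Suc m) = (?e m)(m := True)"
        by (auto simp: fun_eq_iff less_Suc_eq)
      ultimately show ?thesis
        using Suc choice_volume_straighten[of m n "?e m"] by simp
    qed
  qed simp
  from this[of n] show ?thesis
    by (simp cong: choice_volume_cong)
qed

section \<open>Snake and ladder as extreme choices\<close>

theorem theorem3p10:
  fixes n :: nat and w :: snake_word
  assumes "length w = n"
  shows "snake_polytope_volume (snake_poset_word n) \<le> snake_polytope_volume w
       \<and> snake_polytope_volume w \<le> snake_polytope_volume (ladder_poset_word n)"
proof
  \<comment> \<open>The alternating word starts with L, so its step 0 also counts as a change, and
    monotonicity applies vacuously.\<close>
  have "\<not> word_choice (snake_poset_word n) k" if "k < n" for k
    using that by (auto simp: word_choice_def snake_poset_word_def simp del: upt_Suc)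
  then show "snake_polytope_volume (snake_poset_word n) \<le> snake_polytope_volume w"
    using choice_volume_mono[of n "word_choice (snake_poset_word n)"]
    by (simp add: snake_polytope_volume_eq assms snake_poset_word_def del: upt_Suc)
next
  have ladder: "word_choice (ladder_poset_word n) k \<longleftrightarrow> k \<noteq> 0" if "k < n" for k
    using that by (auto simp: word_choice_def ladder_poset_word_def)
  \<comment> \<open>The first L of the ladder counts as a change, so the ladder is not the largest
    choice. The bound therefore goes through the choice with repetitions only, whose step 0 is then
    flipped by exchanging 1 and 2.\<close>
  have "choice_volume n (word_choice w) \<le> choice_volume n (\<lambda>_. True)"
    by (rule choice_volume_mono) simp
  also have "\<dots> \<le> choice_volume n (word_choice (ladder_poset_word n))"
  proof (cases "n = 0")
    case True
    then show ?thesis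
      by (intro order.eq_iff[THEN iffD1, THEN conjunct1] choice_volume_cong) simp
  next
    case False
    then have "choice_volume n (\<lambda>_. True) \<le> choice_volume n ((\<lambda>_. True)(0 := \<not> True))"
      using choice_volume_swap_first[of n "\<lambda>_. True"] by simp
    also have "\<dots> = choice_volume n (word_choice (ladder_poset_word n))"
      by (rule choice_volume_cong) (simp add: ladder)
    finally show ?thesis .
  qed
  finally show "snake_polytope_volume w \<le> snake_polytope_volume (ladder_poset_word n)"
    by (simp add: snake_polytope_volume_eq assms ladder_poset_word_def)
qed

end
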